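(* For any $n$, there exist graphs $G$ with $n$ vertices such that any algorithm using $\texttt{Degree}$, $\texttt{Neighbor}$, $\texttt{EdgeExist}$ and $\texttt{Random Edge}$ queries that computes an $(\varepsilon_\mathcal{D},\varepsilon_\mathcal{R})$-BiCriteria Multiplicative Approximation of the ccdh of the graph, for any $\varepsilon_\mathcal{D}<\frac12$ and $\varepsilon_\mathcal{R}<1$, must use $\Omega(n)$ queries.
   Context: Queries on a simple graph $G=(V,E)$ (algorithms may be randomized and adaptive): $\texttt{Degree}(v)$ returns $\deg(v)$; $\texttt{Neighbor}(v,i)$ returns the $i$-th neighbor of $v$ if it exists and $\perp$ otherwise; $\texttt{EdgeExist}(u,v)$ returns $1$ if $(u,v)\in E$ and $0$ otherwise; $\texttt{Random Edge}$ returns a uniformly random edge of $E$. The ccdh is $C(y)=|\{v\in V:\deg(v)\ge y\}|$. $\widehat{C}$ is an $(\varepsilon_\mathcal{D},\varepsilon_\mathcal{R})$-BiCriteria Multiplicative Approximation of $C$ if for every $d$, $(1-\varepsilon_\mathcal{R})C((1+\varepsilon_\mathcal{D})d)\le\widehat{C}(d)\le(1+\varepsilon_\mathcal{R})C((1-\varepsilon_\mathcal{D})d)$. *)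

theory Defs
  imports "HOL-Probability.Probability" "HOL-Library.Landau_Symbols"
begin

text \<open>The vertex set of a graph with n vertices is \<open>{..<n}\<close>; an edge is a two-element set.\<close>

definition simple_graph :: "nat \<Rightarrow> nat set set \<Rightarrow> bool" where
  "simple_graph n E \<longleftrightarrow> E \<subseteq> {{u, v} | u v. u < n \<and> v < n \<and> u \<noteq> v}"

definition nbrs :: "nat set set \<Rightarrow> nat \<Rightarrow> nat set" where
  "nbrs E v = {u. {v, u} \<in> E}"

definition deg :: "nat set set \<Rightarrow> nat \<Rightarrow> nat" where
  "deg E v = card (nbrs E v)"

text \<open>The argument of the ccdh is real because it is evaluated at \<open>(1 \<plusminus> \<epsilon>) d\<close>.\<close>

definition ccdh :: "nat \<Rightarrow> nat set set \<Rightarrow> real \<Rightarrow> nat" where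
  "ccdh n E y = card {v. v < n \<and> real (deg E v) \<ge> y}"

definition bicriteria_approx ::
    "real \<Rightarrow> real \<Rightarrow> nat \<Rightarrow> nat set set \<Rightarrow> (nat \<Rightarrow> real) \<Rightarrow> bool" where
  "bicriteria_approx \<epsilon>D \<epsilon>R n E C' \<longleftrightarrow>
     (\<forall>d. (1 - \<epsilon>R) * real (ccdh n E ((1 + \<epsilon>D) * real d)) \<le> C' d \<and>
          C' d \<le> (1 + \<epsilon>R) * real (ccdh n E ((1 - \<epsilon>D) * real d)))"

datatype query = Degree nat | Neighbor nat nat | EdgeExist nat nat | RandomEdge

datatype answer = Num nat | Vertex "nat option" | Edge "nat set option"

text \<open>
  A convention that fixes, for every graph on n vertices, the order in which the
  neighbors of each vertex are listed.
\<close>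

definition neighbor_order :: "nat \<Rightarrow> (nat set set \<Rightarrow> nat \<Rightarrow> nat list) \<Rightarrow> bool" where
  "neighbor_order n nb \<longleftrightarrow>
     (\<forall>E v. simple_graph n E \<longrightarrow> distinct (nb E v) \<and> set (nb E v) = nbrs E v)"

text \<open>
  \<open>Neighbor v i\<close> counts neighbors from 1, and \<open>None\<close> stands for \<open>\<bottom>\<close>; a graph without
  edges answers \<open>RandomEdge\<close> by \<open>None\<close>. Every call of the oracle is sampled afresh.
\<close>

fun oracle_of :: "(nat set set \<Rightarrow> nat \<Rightarrow> nat list) \<Rightarrow> nat set set \<Rightarrow> query \<Rightarrow> answer pmf" where
  "oracle_of nb E (Degree v) = return_pmf (Num (deg E v))"
| "oracle_of nb E (Neighbor v i) = return_pmf (Vertex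
     (if 1 \<le> i \<and> i \<le> length (nb E v) then Some (nb E v ! (i - 1)) else None))"
| "oracle_of nb E (EdgeExist u v) = return_pmf (Num (if {u, v} \<in> E then 1 else 0))"
| "oracle_of nb E RandomEdge =
     (if E = {} then return_pmf (Edge None) else map_pmf (\<lambda>e. Edge (Some e)) (pmf_of_set E))"

text \<open>
  A randomized adaptive algorithm: the transcript of earlier queries and answers determines
  the distribution of the next action, which is either a query or halting with an output
  function. Computation between queries is free and unrestricted.
\<close>

datatype action = Ask query | Halt "nat \<Rightarrow> real"

type_synonym algorithm = "(query \<times> answer) list \<Rightarrow> action pmf"

text \<open>
  \<open>run orc A k h\<close> is the output of \<open>A\<close> continued from transcript \<open>h\<close> if it halts after at most
  \<open>k\<close> further queries, and \<open>None\<close> if it asks a query number \<open>k + 1\<close>.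
\<close>

primrec run :: "(query \<Rightarrow> answer pmf) \<Rightarrow> algorithm \<Rightarrow> nat \<Rightarrow> (query \<times> answer) list
    \<Rightarrow> (nat \<Rightarrow> real) option pmf" where
  "run orc A 0 h =
     map_pmf (\<lambda>a. case a of Halt C' \<Rightarrow> Some C' | Ask q \<Rightarrow> None) (A h)"
| "run orc A (Suc k) h =
     bind_pmf (A h) (\<lambda>a. case a of
         Halt C' \<Rightarrow> return_pmf (Some C')
       | Ask q \<Rightarrow> bind_pmf (orc q) (\<lambda>r. run orc A k (h @ [(q, r)])))"

text \<open>
  With T the (possibly infinite) number of queries, this is the tail-sum formula
  \<open>E[T] = (\<Sum>k. P(T > k))\<close>.
\<close>

definition expected_queries :: "(query \<Rightarrow> answer pmf) \<Rightarrow> algorithm \<Rightarrow> ennreal" where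
  "expected_queries orc A = (\<Sum>k. ennreal (pmf (run orc A k []) None))"

text \<open>
  The probability that the algorithm halts with an output satisfying \<open>P\<close>; the supremum is
  over a nondecreasing sequence, so it is the limit.
\<close>

definition output_prob :: "(query \<Rightarrow> answer pmf) \<Rightarrow> algorithm \<Rightarrow> ((nat \<Rightarrow> real) \<Rightarrow> bool) \<Rightarrow> real" where
  "output_prob orc A P = (SUP k. measure_pmf.prob (run orc A k []) (Some ` {C'. P C'}))"

definition computes_bicriteria_approx ::
    "(nat set set \<Rightarrow> nat \<Rightarrow> nat list) \<Rightarrow> real \<Rightarrow> real \<Rightarrow> nat \<Rightarrow> algorithm \<Rightarrow> bool" where
  "computes_bicriteria_approx nb \<epsilon>D \<epsilon>R n A \<longleftrightarrow>
     (\<forall>E. simple_graph n E \<longrightarrow>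
        output_prob (oracle_of nb E) A (bicriteria_approx \<epsilon>D \<epsilon>R n E) \<ge> 2 / 3)"

end

theory Submission imports Defs
begin

text \<open>
  The base graph is a matching, which splits into blocks of four vertices. Two extra edges
  in one block create a vertex of degree three, and the value at \<open>d = 2\<close> of any
  approximation must be positive if such a vertex exists and at most zero otherwise.
  A query naming a vertex reveals at most one block, and a random edge is one of the two
  extra edges with probability \<open>O(1/n)\<close>. Hence the differences between the output
  probabilities on the base graph and on the modified graphs, summed over all blocks, grow by
  at most one per query. So for each \<open>k\<close> there is a block whose
  modification is detected within \<open>k\<close> queries with probability only \<open>O(k/n)\<close>, and an algorithm that is correct on all the graphs must
  still be running on the base graph with constant probability if \<open>k\<close> is a small
  fraction of \<open>n\<close>.
\<close>

section \<open>Transcripts of an algorithm run against similar oracles\<close>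

lemma integrable_prob_pmf:
  fixes M :: "'a pmf" and N :: "'a \<Rightarrow> 'b pmf"
  shows "integrable (measure_pmf M) (\<lambda>x. measure_pmf.prob (N x) S)"
  by (rule measure_pmf.integrable_const_bound[where B = 1]) auto

lemma prob_bind_pmf:
  "measure_pmf.prob (bind_pmf M N) S = measure_pmf.expectation M (\<lambda>x. measure_pmf.prob (N x) S)"
  unfolding measure_pmf_bind
  by (subst measure_pmf.measure_bind[where N = "count_space UNIV"])
    (auto simp: measure_pmf_in_subprob_algebra)

text \<open>Used with \<open>c = 1 - \<delta>\<close>: pointwise domination of one answer
  distribution by another bounds the loss in the probability of any later event by \<delta>.\<close>

lemma expectation_pmf_scaled_mono:
  fixes F :: "'a \<Rightarrow> real"
  assumes "\<And>r. c * pmf p r \<le> pmf q r" and F: "\<And>r. 0 \<le> F r" "\<And>r. F r \<le> 1"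
  shows "c * measure_pmf.expectation p F \<le> measure_pmf.expectation q F"
proof -
  have expectation: "measure_pmf.expectation p F = (\<integral>r. pmf p r * F r \<partial>count_space UNIV)"
    and integrable: "integrable (count_space UNIV) (\<lambda>r. pmf p r * F r)" for p :: "'a pmf"
  proof -
    show "measure_pmf.expectation p F = (\<integral>r. pmf p r * F r \<partial>count_space UNIV)"
      unfolding measure_pmf_eq_density by (subst integral_density) auto
    have "integrable (measure_pmf p) F"
      by (rule measure_pmf.integrable_const_bound[where B = 1]) (use F in auto)
    then show "integrable (count_space UNIV) (\<lambda>r. pmf p r * F r)"
      unfolding measure_pmf_eq_density by (subst (asm) integrable_density) auto
  qed
  have "(\<integral>r. c * (pmf p r * F r) \<partial>count_space UNIV) \<le> (\<integral>r. pmf q r * F r \<partial>count_space UNIV)"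
  proof (rule integral_mono)
    show "c * (pmf p r * F r) \<le> pmf q r * F r" for r
      using mult_right_mono[OF assms(1) F(1)] by (simp add: mult.assoc)
  qed (use integrable in auto)
  then show ?thesis
    by (simp add: expectation)
qed

lemma prob_run_Suc:
  "measure_pmf.prob (run orc A (Suc k) h) S =
     measure_pmf.expectation (A h) (\<lambda>a. case a of
         Halt C' \<Rightarrow> indicator S (Some C')
       | Ask q \<Rightarrow> measure_pmf.expectation (orc q)
           (\<lambda>r. measure_pmf.prob (run orc A k (h @ [(q, r)])) S))"
  by (auto simp: prob_bind_pmf intro!: Bochner_Integration.integral_cong split: action.split)

lemma prob_run_0:
  "measure_pmf.prob (run orc A 0 h) S =
     measure_pmf.expectation (A h) (\<lambda>a. case a of
         Halt C' \<Rightarrow> indicator S (Some C') | Ask q \<Rightarrow> indicator S None)"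
  unfolding run.simps map_pmf_def prob_bind_pmf
  by (auto intro!: Bochner_Integration.integral_cong split: action.split)

lemma expectation_prob_bounds:
  fixes M :: "'a pmf" and N :: "'a \<Rightarrow> 'b pmf"
  shows "0 \<le> measure_pmf.expectation M (\<lambda>x. measure_pmf.prob (N x) S)"
    and "measure_pmf.expectation M (\<lambda>x. measure_pmf.prob (N x) S) \<le> 1"
  by (simp_all flip: prob_bind_pmf)

lemma integrable_action_pmf:
  fixes M :: "action pmf"
  shows "integrable (measure_pmf M) (\<lambda>a. case a of
         Halt C' \<Rightarrow> indicator S (Some C' :: (nat \<Rightarrow> real) option) :: real
       | Ask q \<Rightarrow> measure_pmf.expectation (orc q)
           (\<lambda>r. measure_pmf.prob (run orc A k (h @ [(q, r)])) S))"
  by (rule measure_pmf.integrable_const_bound[where B = 1])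
    (auto split: action.split simp: expectation_prob_bounds)

text \<open>A hybrid argument by induction on the query budget. The sum over \<open>I\<close> is
  kept throughout, so that one query costs the sum of its \<delta>, at most 1, and not 1 for each
  index.\<close>

lemma sum_prob_run_diff_le:
  assumes \<delta>_nonneg: "\<And>q i. i \<in> I \<Longrightarrow> 0 \<le> \<delta> q i"
    and \<delta>_sum: "\<And>q. (\<Sum>i\<in>I. \<delta> q i) \<le> 1"
    and close: "\<And>q i r. i \<in> I \<Longrightarrow> (1 - \<delta> q i) * pmf (orc q) r \<le> pmf (orc' i q) r"
  shows "(\<Sum>i\<in>I. measure_pmf.prob (run orc A k h) S - measure_pmf.prob (run (orc' i) A k h) S)
    \<le> real k"
proof (induction k arbitrary: h)
  case 0
  show ?case by (simp add: prob_run_0 del: run.simps)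
next
  case (Suc k)
  let ?p = "\<lambda>orc h. measure_pmf.prob (run orc A k h) S"
  let ?e = "\<lambda>orc h q. measure_pmf.expectation (orc q) (\<lambda>r. ?p orc (h @ [(q, r)]))"
  let ?a = "\<lambda>orc a. case a of Halt C' \<Rightarrow> indicator S (Some C') | Ask q \<Rightarrow> ?e orc h q"
  have ask: "(\<Sum>i\<in>I. ?e orc h q - ?e (orc' i) h q) \<le> real (Suc k)" for q
  proof -
    let ?E = "measure_pmf.expectation (orc q)"
    \<comment> \<open>Replacing \<open>orc' i\<close> by \<open>orc\<close> for the current answer
      costs \<open>\<delta> q i\<close>. Afterwards all indices average over the same distribution
      \<open>orc q\<close>, so the sum moves inside and the induction hypothesis applies to each
      answer.\<close>
    have "?e orc h q - ?e (orc' i) h q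
        \<le> ?E (\<lambda>r. ?p orc (h @ [(q, r)]) - ?p (orc' i) (h @ [(q, r)])) + \<delta> q i"
      if "i \<in> I" for i
    proof -
      have "(1 - \<delta> q i) * ?E (\<lambda>r. ?p (orc' i) (h @ [(q, r)])) \<le> ?e (orc' i) h q"
        by (rule expectation_pmf_scaled_mono) (use close that in auto)
      moreover have "\<delta> q i * ?E (\<lambda>r. ?p (orc' i) (h @ [(q, r)])) \<le> \<delta> q i"
        using mult_left_mono[OF expectation_prob_bounds(2) \<delta>_nonneg[OF that]] by simp
      ultimately show ?thesis
        by (simp add: integrable_prob_pmf algebra_simps)
    qed
    then have "(\<Sum>i\<in>I. ?e orc h q - ?e (orc' i) h q)
        \<le> (\<Sum>i\<in>I. ?E (\<lambda>r. ?p orc (h @ [(q, r)]) - ?p (orc' i) (h @ [(q, r)])))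
          + (\<Sum>i\<in>I. \<delta> q i)"
      by (simp add: sum_mono flip: sum.distrib)
    also have "(\<Sum>i\<in>I. ?E (\<lambda>r. ?p orc (h @ [(q, r)]) - ?p (orc' i) (h @ [(q, r)])))
        = ?E (\<lambda>r. \<Sum>i\<in>I. ?p orc (h @ [(q, r)]) - ?p (orc' i) (h @ [(q, r)]))"
      by (rule Bochner_Integration.integral_sum[symmetric])
        (intro Bochner_Integration.integrable_diff integrable_prob_pmf)
    also have "\<dots> \<le> real k"
      by (rule measure_pmf.integral_le_const)
        (auto intro!: integrable_prob_pmf Suc.IH)
    finally show ?thesis using \<delta>_sum[of q] by simp
  qed
  have int: "integrable (measure_pmf (A h)) (?a orc)" for orc
    by (rule integrable_action_pmf)
  have "(\<Sum>i\<in>I. measure_pmf.prob (run orc A (Suc k) h) S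
        - measure_pmf.prob (run (orc' i) A (Suc k) h) S)
      = measure_pmf.expectation (A h) (\<lambda>a. \<Sum>i\<in>I. ?a orc a - ?a (orc' i) a)"
    unfolding prob_run_Suc using int
    by (subst Bochner_Integration.integral_sum) simp_all
  also have "\<dots> \<le> real (Suc k)"
  proof (rule measure_pmf.integral_le_const)
    show "AE a in measure_pmf (A h). (\<Sum>i\<in>I. ?a orc a - ?a (orc' i) a) \<le> real (Suc k)"
      using ask by (auto split: action.split)
  qed (use int in auto)
  finally show ?case .
qed

section \<open>Events of halting as the query budget grows\<close>

lemma prob_run_Some_mono_Suc:
  "measure_pmf.prob (run orc A k h) (Some ` Q) \<le> measure_pmf.prob (run orc A (Suc k) h) (Some ` Q)"
proof (induction k arbitrary: h)
  case 0
  \<comment> \<open>Without budget an \<open>Ask\<close> ends in \<open>None\<close>, which lies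
    outside the event and so contributes 0.\<close>
  show ?case unfolding prob_run_0[of _ _ h] prob_run_Suc
    by (intro integral_mono integrable_action_pmf measure_pmf.integrable_const_bound[where B = 1])
      (auto split: action.split simp: expectation_prob_bounds)
next
  case (Suc k)
  show ?case
    unfolding prob_run_Suc[of _ _ k h] prob_run_Suc[of _ _ "Suc k" h]
  proof (intro integral_mono integrable_action_pmf)
    let ?v = "\<lambda>k a. case a of Halt C' \<Rightarrow> indicator (Some ` Q) (Some C')
        | Ask q \<Rightarrow> measure_pmf.expectation (orc q)
            (\<lambda>r. measure_pmf.prob (run orc A k (h @ [(q, r)])) (Some ` Q))"
    show "?v k a \<le> ?v (Suc k) a" for a
      by (cases a) (simp_all del: run.simps add: integral_mono integrable_prob_pmf Suc.IH)
  qed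
qed

lemma mono_prob_run_Some: "mono (\<lambda>k. measure_pmf.prob (run orc A k h) (Some ` Q))"
  by (rule incseq_SucI) (rule prob_run_Some_mono_Suc)

text \<open>By monotonicity both probabilities can be raised to the common budget
  \<open>max j k\<close>, where they belong to disjoint events of a single distribution.\<close>

lemma output_prob_disjoint:
  assumes "\<And>C'. P C' \<Longrightarrow> C' \<notin> Q"
  shows "output_prob orc A P + measure_pmf.prob (run orc A k []) (Some ` Q) \<le> 1"
proof -
  have "measure_pmf.prob (run orc A j []) (Some ` {C'. P C'})
      \<le> 1 - measure_pmf.prob (run orc A k []) (Some ` Q)" for j
  proof -
    let ?M = "measure_pmf (run orc A (max j k) [])"
    have "measure_pmf.prob (run orc A j []) (Some ` {C'. P C'})
        + measure_pmf.prob (run orc A k []) (Some ` Q)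
        \<le> measure ?M (Some ` {C'. P C'}) + measure ?M (Some ` Q)"
      by (intro add_mono monoD[OF mono_prob_run_Some]) auto
    also have "\<dots> = measure ?M (Some ` {C'. P C'} \<union> Some ` Q)"
      by (rule measure_pmf.finite_measure_Union[symmetric]) (use assms in auto)
    also have "\<dots> \<le> 1" by simp
    finally show ?thesis by simp
  qed
  then have "output_prob orc A P \<le> 1 - measure_pmf.prob (run orc A k []) (Some ` Q)"
    unfolding output_prob_def by (intro cSUP_least) auto
  then show ?thesis by simp
qed

section \<open>A matching with a hidden vertex of degree three\<close>

definition matching :: "nat \<Rightarrow> nat set set" where
  "matching g = (\<lambda>j. {2 * j, 2 * j + 1}) ` {..<2 * g}"

text \<open>The new edges join \<open>4 * i\<close> to both ends of the other matching edge of its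
  block, so they stay inside the block.\<close>

definition hidden :: "nat \<Rightarrow> nat \<Rightarrow> nat set set" where
  "hidden g i = matching g \<union> {{4 * i, 4 * i + 2}, {4 * i, 4 * i + 3}}"

lemma card_matching: "card (matching g) = 2 * g"
proof -
  have "inj_on (\<lambda>j::nat. {2 * j, 2 * j + 1}) {..<2 * g}"
    by (rule inj_onI) (auto simp: doubleton_eq_iff; presburger)
  then show ?thesis by (simp add: matching_def card_image)
qed

lemma card_hidden_le: "card (hidden g i) \<le> 2 * g + 2"
proof -
  have "card (hidden g i) \<le> card (matching g) + card {{4 * i, 4 * i + 2}, {4 * i, 4 * i + 3}}"
    unfolding hidden_def by (rule card_Un_le)
  also have "card {{4 * i, 4 * i + 2}, {4 * i, 4 * i + 3}} \<le> 2"
    by (simp add: card_insert_if)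
  finally show ?thesis by (simp add: card_matching)
qed

lemma finite_hidden: "finite (hidden g i)" and finite_matching: "finite (matching g)"
  by (auto simp: hidden_def matching_def)

lemma simple_graph_matching:
  assumes "4 * g \<le> n"
  shows "simple_graph n (matching g)"
  unfolding simple_graph_def matching_def
proof (rule image_subsetI)
  fix j assume "j \<in> {..<2 * g}"
  with assms show "{2 * j, 2 * j + 1} \<in> {{u, v} |u v. u < n \<and> v < n \<and> u \<noteq> v}"
    by (intro CollectI exI[of _ "2 * j"] exI[of _ "2 * j + 1"]) auto
qed

lemma simple_graph_hidden:
  assumes "4 * g \<le> n" "i < g"
  shows "simple_graph n (hidden g i)"
proof -
  have "{4 * i, 4 * i + c} \<in> {{u, v} |u v. u < n \<and> v < n \<and> u \<noteq> v}" if "0 < c" "c < 4" for c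
    using assms that by (intro CollectI exI[of _ "4 * i"] exI[of _ "4 * i + c"]) auto
  from this[of 2] this[of 3] show ?thesis
    using simple_graph_matching[OF assms(1)] by (auto simp: hidden_def simple_graph_def)
qed

lemma nbrs_matching: "nbrs (matching g) v \<subseteq> {if even v then v + 1 else v - 1}"
  by (auto simp: nbrs_def matching_def doubleton_eq_iff)

lemma deg_matching_le: "deg (matching g) v \<le> 1"
  unfolding deg_def using card_mono[OF _ nbrs_matching, of v g] by simp

text \<open>Each new edge has both ends in block \<open>i\<close>, so one endpoint outside the block
  decides. Hence an \<open>EdgeExist\<close> query can be charged to its first vertex alone.\<close>

lemma edge_hidden_iff:
  "v div 4 \<noteq> i \<Longrightarrow> {v, u} \<in> hidden g i \<longleftrightarrow> {v, u} \<in> matching g"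
  by (auto simp: hidden_def doubleton_eq_iff)

lemma nbrs_hidden: "v div 4 \<noteq> i \<Longrightarrow> nbrs (hidden g i) v = nbrs (matching g) v"
  by (simp add: nbrs_def edge_hidden_iff)

lemma deg_hidden_ge:
  assumes "i < g"
  shows "3 \<le> deg (hidden g i) (4 * i)"
proof -
  have "{4 * i, 4 * i + 1} \<in> matching g"
    unfolding matching_def by (rule image_eqI[of _ _ "2 * i"]) (use assms in auto)
  then have "{4 * i + 1, 4 * i + 2, 4 * i + 3} \<subseteq> nbrs (hidden g i) (4 * i)"
    by (auto simp: nbrs_def hidden_def)
  moreover have "finite (nbrs (hidden g i) (4 * i))"
    by (rule finite_subset[of _ "\<Union> (hidden g i)"])
      (auto simp: nbrs_def hidden_def matching_def)
  ultimately have "card {4 * i + 1, 4 * i + 2, 4 * i + 3} \<le> deg (hidden g i) (4 * i)"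
    unfolding deg_def by (intro card_mono)
  then show ?thesis by simp
qed

text \<open>A neighbor order may depend on the whole graph, so equal neighbor sets need not give
  equal lists in general. Lists with at most one entry leave no such freedom.\<close>

lemma distinct_eq_if_set_eq_subsingleton:
  assumes "distinct xs" "distinct ys" "set xs = set ys" "set xs \<subseteq> {x}"
  shows "xs = ys"
proof -
  have "length xs \<le> 1"
    using assms(1,4) card_mono[of "{x}" "set xs"] by (simp add: distinct_card)
  moreover have "length xs = length ys"
    using assms(1,2,3) by (metis distinct_card)
  ultimately show ?thesis
    using assms(3) by (cases xs; cases ys) auto
qed

lemma neighbor_list_hidden:
  assumes "neighbor_order n nb" "4 * g \<le> n" "i < g" "v div 4 \<noteq> i"
  shows "nb (hidden g i) v = nb (matching g) v"
proof (rule distinct_eq_if_set_eq_subsingleton)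
  note nb = assms(1)[unfolded neighbor_order_def, rule_format]
  note nbG = nb[OF simple_graph_matching[OF assms(2)], of v]
  note nbH = nb[OF simple_graph_hidden[OF assms(2,3)], of v]
  show "distinct (nb (hidden g i) v)" "distinct (nb (matching g) v)"
    "set (nb (hidden g i) v) = set (nb (matching g) v)"
    "set (nb (hidden g i) v) \<subseteq> {if even v then v + 1 else v - 1}"
    using nbG nbH nbrs_hidden[OF assms(4), of g] nbrs_matching[of g v] by auto
qed

text \<open>
  The total change of the answer distributions over all hiding places: a query naming a
  vertex \<open>v\<close> can only be affected by the place \<open>v div 4\<close>, and a random edge misses
  the two new edges with probability at least \<open>2g / (2g + 2)\<close>.
\<close>

fun perturbation :: "nat \<Rightarrow> query \<Rightarrow> nat \<Rightarrow> real" where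
  "perturbation g (Degree v) i = of_bool (i = v div 4)"
| "perturbation g (Neighbor v _) i = of_bool (i = v div 4)"
| "perturbation g (EdgeExist v _) i = of_bool (i = v div 4)"
| "perturbation g RandomEdge i = 1 / (real g + 1)"

lemma perturbation_nonneg: "0 \<le> perturbation g q i"
  by (cases q) auto

lemma sum_perturbation_le: "(\<Sum>i<g. perturbation g q i) \<le> 1"
proof -
  have "(\<Sum>i<g. of_bool (i = j)) \<le> (1::real)" for j :: nat
    by (simp add: of_bool_def)
  then show ?thesis
    by (cases q) (simp_all add: divide_simps del: sum_of_bool_eq)
qed

lemma pmf_map_Edge_of_set:
  assumes "finite E" "E \<noteq> {}"
  shows "pmf (map_pmf (\<lambda>e. Edge (Some e)) (pmf_of_set E)) r
    = (case r of Edge (Some e) \<Rightarrow> indicator E e / card E | _ \<Rightarrow> 0)"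
proof -
  have "inj (\<lambda>e. Edge (Some e))" by (rule injI) simp
  from pmf_map_inj'[OF this, of "pmf_of_set E"]
  have "pmf (map_pmf (\<lambda>e. Edge (Some e)) (pmf_of_set E)) (Edge (Some e))
      = indicator E e / card E" for e
    using assms by simp
  moreover have "pmf (map_pmf (\<lambda>e. Edge (Some e)) (pmf_of_set E)) r = 0"
    if "r \<notin> range (\<lambda>e. Edge (Some e))"
    using that by (auto simp: pmf_eq_0_set_pmf)
  ultimately show ?thesis
    by (auto split: answer.split option.split)
qed

text \<open>For a query naming a vertex, either the perturbation is 1 and the left side vanishes, or
  both graphs give the same answer.\<close>

lemma pmf_oracle_hidden_ge:
  assumes "neighbor_order n nb" "4 * g \<le> n" "i < g"
  shows "(1 - perturbation g q i) * pmf (oracle_of nb (matching g) q) r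
    \<le> pmf (oracle_of nb (hidden g i) q) r"
proof (cases q)
  case (Degree v)
  then show ?thesis by (auto simp: deg_def nbrs_hidden)
next
  case (Neighbor v k)
  then show ?thesis by (auto simp: neighbor_list_hidden[OF assms])
next
  case (EdgeExist v u)
  then show ?thesis by (auto simp: edge_hidden_iff)
next
  case RandomEdge
  have G: "matching g \<noteq> {}" and H: "hidden g i \<noteq> {}"
    using assms(3) card_matching[of g] by (auto simp: hidden_def)
  have "(1 - 1 / (real g + 1)) * (indicator (matching g) e / real (card (matching g)))
      \<le> indicator (hidden g i) e / real (card (hidden g i))" for e
  proof (cases "e \<in> matching g")
    case True
    \<comment> \<open>The factor is \<open>g / (g + 1)\<close>, the ratio of the edge count
      \<open>2 * g\<close> to the bound \<open>2 * g + 2\<close>.\<close>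
    have "(1 - 1 / (real g + 1)) * (1 / real (2 * g)) = 1 / real (2 * g + 2)"
      using assms(3) by (simp add: divide_simps)
    also have "\<dots> \<le> 1 / real (card (hidden g i))"
      using card_hidden_le[of g i] H finite_hidden[of g i]
      by (intro divide_left_mono) (auto simp: card_gt_0_iff)
    finally show ?thesis using True by (simp add: card_matching hidden_def)
  qed auto
  then show ?thesis
    using RandomEdge G H
    by (auto simp: pmf_map_Edge_of_set finite_matching finite_hidden
        split: answer.split option.split)
qed

section \<open>What a correct output says at \<open>d = 2\<close>\<close>

lemma approx_matching_imp:
  assumes "bicriteria_approx \<epsilon>D \<epsilon>R n (matching g) C'" "\<epsilon>D < 1 / 2"
  shows "C' 2 \<le> 0"
proof -
  \<comment> \<open>The choice \<open>d = 2\<close> puts the lower threshold above 1, the largest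
    possible degree in the matching.\<close>
  have "\<not> (1 - \<epsilon>D) * real 2 \<le> real (deg (matching g) v)" for v
    using assms(2) deg_matching_le[of g v] by simp
  then have "ccdh n (matching g) ((1 - \<epsilon>D) * real 2) = 0"
    by (simp add: ccdh_def)
  moreover have "C' 2 \<le> (1 + \<epsilon>R) * real (ccdh n (matching g) ((1 - \<epsilon>D) * real 2))"
    using assms(1) unfolding bicriteria_approx_def by blast
  ultimately show ?thesis by simp
qed

lemma approx_hidden_imp:
  assumes "bicriteria_approx \<epsilon>D \<epsilon>R n (hidden g i) C'" "\<epsilon>D < 1 / 2" "\<epsilon>R < 1"
    and "4 * g \<le> n" "i < g"
  shows "C' 2 > 0"
proof -
  \<comment> \<open>The upper threshold stays below 3.\<close>
  have "4 * i \<in> {v. v < n \<and> real (deg (hidden g i) v) \<ge> (1 + \<epsilon>D) * real 2}"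
    using assms(2,4,5) deg_hidden_ge[OF assms(5)] by simp
  then have "ccdh n (hidden g i) ((1 + \<epsilon>D) * real 2) > 0"
    unfolding ccdh_def by (subst card_gt_0_iff) auto
  then have "0 < (1 - \<epsilon>R) * real (ccdh n (hidden g i) ((1 + \<epsilon>D) * real 2))"
    using assms(3) by simp
  also have "\<dots> \<le> C' 2"
    using assms(1) unfolding bicriteria_approx_def by blast
  finally show ?thesis .
qed

section \<open>The lower bound\<close>

lemma pmf_run_None_ge:
  assumes nb: "neighbor_order n nb" and \<epsilon>: "\<epsilon>D < 1 / 2" "\<epsilon>R < 1"
    and A: "computes_bicriteria_approx nb \<epsilon>D \<epsilon>R n A"
    and g: "4 * g \<le> n" "0 < g"
  shows "pmf (run (oracle_of nb (matching g)) A k []) None \<ge> 1 / 3 - real k / real g"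
proof -
  \<comment> \<open>\<open>Q\<close> separates the two cases: correct outputs lie in
    \<open>Q\<close> on the matching and outside it on every hidden graph.\<close>
  define Q where "Q = {C' :: nat \<Rightarrow> real. C' 2 \<le> 0}"
  let ?R = "\<lambda>E. run (oracle_of nb E) A k []"
  let ?p = "\<lambda>E. measure_pmf.prob (?R E) (Some ` Q)"
  have correct: "output_prob (oracle_of nb E) A (bicriteria_approx \<epsilon>D \<epsilon>R n E) \<ge> 2 / 3"
    if "simple_graph n E" for E
    using A that by (auto simp: computes_bicriteria_approx_def)
  have hidden: "?p (hidden g i) \<le> 1 / 3" if "i < g" for i
    using correct[OF simple_graph_hidden[OF g(1) that]]
      output_prob_disjoint[of "bicriteria_approx \<epsilon>D \<epsilon>R n (hidden g i)" Q
        "oracle_of nb (hidden g i)" A k]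
      approx_hidden_imp[OF _ \<epsilon> g(1) that] by (force simp: Q_def)
  have other: "measure_pmf.prob (?R (matching g)) (Some ` (- Q)) \<le> 1 / 3"
    using correct[OF simple_graph_matching[OF g(1)]]
      output_prob_disjoint[of "bicriteria_approx \<epsilon>D \<epsilon>R n (matching g)" "- Q"
        "oracle_of nb (matching g)" A k]
      approx_matching_imp[OF _ \<epsilon>(1)] by (force simp: Q_def)
  have "x \<in> Some ` Q \<union> Some ` (- Q) \<union> {None}" for x
    by (cases x) auto
  then have "Some ` Q \<union> Some ` (- Q) \<union> {None} = UNIV"
    by blast
  then have "1 = measure_pmf.prob (?R (matching g)) (Some ` Q \<union> Some ` (- Q) \<union> {None})"
    by simp
  also have "\<dots> \<le> measure_pmf.prob (?R (matching g)) (Some ` Q \<union> Some ` (- Q))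
      + pmf (?R (matching g)) None"
    using measure_Un_le[of "Some ` Q \<union> Some ` (- Q)" "measure_pmf (?R (matching g))" "{None}"]
    by (simp add: measure_pmf_single)
  also have "measure_pmf.prob (?R (matching g)) (Some ` Q \<union> Some ` (- Q))
      \<le> ?p (matching g) + measure_pmf.prob (?R (matching g)) (Some ` (- Q))"
    by (rule measure_Un_le) simp_all
  finally have none: "2 / 3 - ?p (matching g) \<le> pmf (?R (matching g)) None"
    using other by simp
  \<comment> \<open>Averaging over the \<open>g\<close> hiding places turns the bound
    \<open>k\<close> on the total into \<open>k / g\<close>.\<close>
  have "real g * (?p (matching g) - 1 / 3) \<le> (\<Sum>i<g. ?p (matching g) - ?p (hidden g i))"
    using sum_mono[of "{..<g}" "\<lambda>i. ?p (matching g) - 1 / 3"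
        "\<lambda>i. ?p (matching g) - ?p (hidden g i)"] hidden by simp
  also have "\<dots> \<le> real k"
    by (rule sum_prob_run_diff_le[where \<delta> = "perturbation g"])
      (auto simp: perturbation_nonneg sum_perturbation_le
        intro!: pmf_oracle_hidden_ge[OF nb g(1)])
  finally have "?p (matching g) - 1 / 3 \<le> real k / real g"
    using g(2) by (simp add: pos_le_divide_eq mult.commute)
  with none show ?thesis by simp
qed

lemma expected_queries_ge:
  assumes "neighbor_order n nb" "\<epsilon>D < 1 / 2" "\<epsilon>R < 1"
    and "computes_bicriteria_approx nb \<epsilon>D \<epsilon>R n A"
  shows "of_nat (n div 144) \<le> expected_queries (oracle_of nb (matching (n div 4))) A"
proof -
  let ?p = "\<lambda>k. pmf (run (oracle_of nb (matching (n div 4))) A k []) None"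
  \<comment> \<open>Here \<open>k\<close> is at most a sixth of the number of blocks, which leaves
    \<open>1 / 3 - 1 / 6\<close>. Summing 1/6 over \<open>n div 24\<close> terms of the tail sum
    yields the constant 144.\<close>
  have p: "1 / 6 \<le> ?p k" if "k < n div 24" for k
  proof -
    have g: "6 * k \<le> n div 4" "0 < n div 4" using that by linarith+
    then have "real k / real (n div 4) \<le> 1 / 6"
      by (simp add: pos_divide_le_eq)
    with pmf_run_None_ge[OF assms _ g(2), of k] show ?thesis by simp
  qed
  have "6 * (n div 144) \<le> n div 24"
    by linarith
  then have "real (n div 144) \<le> real (n div 24) * (1 / 6)"
    by simp
  also have "\<dots> \<le> (\<Sum>k<n div 24. ?p k)"
    using sum_mono[of "{..<n div 24}" "\<lambda>_. 1 / 6" ?p] p by simp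
  finally have "ennreal (real (n div 144)) \<le> ennreal (\<Sum>k<n div 24. ?p k)"
    by (rule ennreal_leI)
  also have "\<dots> = (\<Sum>k<n div 24. ennreal (?p k))"
    by simp
  also have "\<dots> \<le> (\<Sum>k. ennreal (?p k))"
    by (rule sum_le_suminf) auto
  finally show ?thesis
    by (simp add: expected_queries_def ennreal_of_nat_eq_real_of_nat)
qed

text \<open>Once \<open>n \<ge> c\<close> the quotient is at least 1, so rounding down loses at most
  a factor 2.\<close>

lemma div_in_bigomega:
  assumes "0 < c"
  shows "(\<lambda>n. real (n div c)) \<in> \<Omega>(\<lambda>n. real n)"
proof (rule landau_omega.bigI)
  show "0 < 1 / (2 * real c)" using assms by simp
  have "1 / (2 * real c) * real n \<le> real (n div c)" if "n \<ge> c" for n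
  proof -
    have "n < c * (n div c) + c"
      using assms by (metis add_strict_left_mono mod_less_divisor mult_div_mod_eq)
    moreover have "c * 1 \<le> c * (n div c)"
      using assms that by (intro mult_left_mono) (simp_all add: Suc_le_eq div_greater_zero_iff)
    ultimately have "n \<le> 2 * c * (n div c)" by linarith
    then have "real n \<le> 2 * real c * real (n div c)"
      by (metis of_nat_le_iff of_nat_mult of_nat_numeral)
    then show ?thesis using assms by (simp add: field_simps)
  qed
  then show "\<forall>\<^sub>F n in sequentially. norm (real (n div c)) \<ge> 1 / (2 * real c) * norm (real n)"
    by (auto simp: eventually_sequentially)
qed

theorem theorem6p4:
  "\<exists>f :: nat \<Rightarrow> nat. (\<lambda>n. real (f n)) \<in> \<Omega>(\<lambda>n. real n) \<and>
     (\<forall>n. \<exists>G. simple_graph n G \<and>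
        (\<forall>nb \<epsilon>D \<epsilon>R A. neighbor_order n nb \<longrightarrow> \<epsilon>D < 1 / 2 \<longrightarrow> \<epsilon>R < 1 \<longrightarrow>
           computes_bicriteria_approx nb \<epsilon>D \<epsilon>R n A \<longrightarrow>
           of_nat (f n) \<le> expected_queries (oracle_of nb G) A))"
proof (intro exI[of _ "\<lambda>n. n div 144"] conjI allI)
  show "(\<lambda>n. real (n div 144)) \<in> \<Omega>(\<lambda>n. real n)"
    by (rule div_in_bigomega) simp
  show "\<exists>G. simple_graph n G \<and>
        (\<forall>nb \<epsilon>D \<epsilon>R A. neighbor_order n nb \<longrightarrow> \<epsilon>D < 1 / 2 \<longrightarrow> \<epsilon>R < 1 \<longrightarrow>
           computes_bicriteria_approx nb \<epsilon>D \<epsilon>R n A \<longrightarrow>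
           of_nat (n div 144) \<le> expected_queries (oracle_of nb G) A)" for n
    \<comment> \<open>The hard graph is the matching itself, chosen from \<open>n\<close> alone;
      correctness on the hidden graphs is what forces the queries on it.\<close>
    by (intro exI[of _ "matching (n div 4)"] conjI allI impI simple_graph_matching
        expected_queries_ge) auto
qed

end
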